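(* Let $B$ be an abelian group (written additively) with operators in a nonempty set $A$, and let $\sigma_B,\delta_B$ be group endomorphisms of $B$. Suppose that $B$ is stably Noetherian (as a group with operators in $A$), that the action of $A$ on $B$ is weakly $s$-unital, and that $\sigma_B$ is an $A$-stable surjection. Then the Ore group extension $B[x;\sigma_B,\delta_B]$ is stably Noetherian, seen as a group with operators in $A[x]$.
   Context: $\mathbb{N}=\{0,1,2,\ldots\}$, $\mathbb{N}_+=\{1,2,\ldots\}$. An abelian group $G$ has operators in a set $S$ if each $s\in S$ acts on $G$ (written $g\mapsto sg$) as a group endomorphism. A subgroup $H$ of $G$ is stable if $sh\in H$ for all $s\in S$, $h\in H$. $G$ is stably Noetherian if the set of stable subgroups of $G$, ordered by inclusion, satisfies the ascending chain condition. It is assumed that $A$ contains a fixed zero element, i.e. $0\in A$ with $0b=0$ for all $b\in B$. For $b\in B$ and $n\in\mathbb{N}_+$, $A^n b$ is the set of all $a_1(a_2(\cdots(a_nb)\cdots))$ with $a_1,\ldots,a_n\in A$. Let $[b]$ be the set of all finite nonempty sums $b_1+\cdots+b_r$ such that, for each $l$, $b_l$ or $-b_l$ lies in $\bigcup_{n\in\mathbb{N}_+}A^n b$. The action of $A$ on $B$ is weakly $s$-unital if $b\in[b]$ for every $b\in B$. A group endomorphism $f\colon B\to B$ is $A$-stable if for every $b\in B$, $f(Ab)\subseteq Af(b)$, where $Ab=\{ab\mid a\in A\}$. $A[x]$ is the set of formal sums $\sum_{i\in\mathbb{N}}a_ix^i$ with $a_i\in A$, $a_i=0$ for all but finitely many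 $i$; $B[x]$ is defined likewise and is an abelian group under coefficientwise addition. For $i\ge j$, $\pi^i_j\colon B\to B$ is the sum of all $\binom{i}{j}$ compositions of $j$ instances of $\sigma_B$ and $i-j$ instances of $\delta_B$; $\pi^i_j=0$ if $i<j$. The Ore group extension $B[x;\sigma_B,\delta_B]$ is the abelian group $B[x]$ with $A[x]$ as set of operators, the action being $$\Bigl(\sum_{i}a_ix^i\Bigr)\Bigl(\sum_{j}b_jx^j\Bigr)=\sum_{i,j,k\in\mathbb{N}}\bigl(a_i\,\pi_k^i(b_j)\bigr)x^{k+j}.$$ *)

theory Defs
  imports "HOL-Computational_Algebra.Polynomial" "HOL-Library.Groups_Big_Fun"
begin

definition group_with_operators :: "('s \<Rightarrow> 'g::ab_group_add \<Rightarrow> 'g) \<Rightarrow> bool" where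
  "group_with_operators act \<longleftrightarrow> (\<forall>s. additive (act s))"

definition stable_subgroup :: "('s \<Rightarrow> 'g::ab_group_add \<Rightarrow> 'g) \<Rightarrow> 'g set \<Rightarrow> bool" where
  "stable_subgroup act H \<longleftrightarrow>
     0 \<in> H \<and> (\<forall>x\<in>H. \<forall>y\<in>H. x + y \<in> H) \<and> (\<forall>x\<in>H. - x \<in> H) \<and>
     (\<forall>s. \<forall>h\<in>H. act s h \<in> H)"

definition stably_noetherian :: "('s \<Rightarrow> 'g::ab_group_add \<Rightarrow> 'g) \<Rightarrow> bool" where
  "stably_noetherian act \<longleftrightarrow>
     (\<forall>H :: nat \<Rightarrow> 'g set. (\<forall>n. stable_subgroup act (H n)) \<and> mono H
        \<longrightarrow> (\<exists>N. \<forall>n\<ge>N. H n = H N))"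


definition iterated_orbit :: "('a \<Rightarrow> 'b \<Rightarrow> 'b) \<Rightarrow> nat \<Rightarrow> 'b \<Rightarrow> 'b set" where
  "iterated_orbit act n b = {foldr act as b | as. length as = n}"

definition bracket :: "('a \<Rightarrow> 'b::ab_group_add \<Rightarrow> 'b) \<Rightarrow> 'b \<Rightarrow> 'b set" where
  "bracket act b =
     {sum_list bs | bs. bs \<noteq> [] \<and>
        (\<forall>c\<in>set bs. c \<in> (\<Union>n\<in>{1..}. iterated_orbit act n b) \<or>
                    - c \<in> (\<Union>n\<in>{1..}. iterated_orbit act n b))}"

definition weakly_s_unital :: "('a \<Rightarrow> 'b::ab_group_add \<Rightarrow> 'b) \<Rightarrow> bool" where
  "weakly_s_unital act \<longleftrightarrow> (\<forall>b. b \<in> bracket act b)"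

definition stable_map :: "('a \<Rightarrow> 'b \<Rightarrow> 'b) \<Rightarrow> ('b \<Rightarrow> 'b) \<Rightarrow> bool" where
  "stable_map act f \<longleftrightarrow> (\<forall>b. f ` range (\<lambda>a. act a b) \<subseteq> range (\<lambda>a. act a (f b)))"


text \<open>A word \<open>w\<close> of length \<open>i\<close> encodes a composition of \<open>i\<close> maps: \<open>True\<close> stands for
  \<open>\<sigma>\<close> and \<open>False\<close> for \<open>\<delta>\<close>. The sum is over words, so coinciding compositions are counted
  with multiplicity; for \<open>i < j\<close> it is empty.\<close>

definition ore_pi :: "('b::ab_group_add \<Rightarrow> 'b) \<Rightarrow> ('b \<Rightarrow> 'b) \<Rightarrow> nat \<Rightarrow> nat \<Rightarrow> 'b \<Rightarrow> 'b" where
  "ore_pi \<sigma> \<delta> i j b =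
     (\<Sum>w | length w = i \<and> count_list w True = j.
        foldr (\<lambda>s. if s then \<sigma> else \<delta>) w b)"

text \<open>\<open>'a poly\<close> serves as \<open>A[x]\<close> although \<open>A\<close> is only a set with a distinguished zero. The
  range of summation is cut down to a finite set of indices; the lemma \<open>ore_action_Sum_any\<close>
  below shows that this loses no terms.\<close>

definition ore_action ::
  "('a::zero \<Rightarrow> 'b::ab_group_add \<Rightarrow> 'b) \<Rightarrow> ('b \<Rightarrow> 'b) \<Rightarrow> ('b \<Rightarrow> 'b) \<Rightarrow> 'a poly \<Rightarrow> 'b poly \<Rightarrow> 'b poly" where
  "ore_action act \<sigma> \<delta> p q =
     (\<Sum>i\<le>degree p. \<Sum>j\<le>degree q. \<Sum>k\<le>i.
        monom (act (coeff p i) (ore_pi \<sigma> \<delta> i k (coeff q j))) (k + j))"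

lemma ore_pi_eq_0: "ore_pi \<sigma> \<delta> i j b = 0" if "i < j"
proof -
  have "{w. length w = i \<and> count_list w True = j} = {}"
    using that count_le_length[of _ True] by (auto simp: not_le[symmetric])
  then show ?thesis
    by (simp only: ore_pi_def sum.empty)
qed

lemma ore_pi_zero: "ore_pi \<sigma> \<delta> i j 0 = 0" if "additive \<sigma>" "additive \<delta>"
proof -
  have "foldr (\<lambda>s. if s then \<sigma> else \<delta>) w 0 = 0" for w
    by (induction w) (simp_all add: additive.zero that)
  then show ?thesis
    by (simp add: ore_pi_def)
qed

lemma ore_action_Sum_any:
  assumes "group_with_operators act" "\<And>b. act 0 b = 0" "additive \<sigma>" "additive \<delta>"
  shows "ore_action act \<sigma> \<delta> p q =
     Sum_any (\<lambda>(i, j, k). monom (act (coeff p i) (ore_pi \<sigma> \<delta> i k (coeff q j))) (k + j))"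
    (is "_ = Sum_any ?g")
proof -
  let ?S = "SIGMA i:{..degree p}. {..degree q} \<times> {..i}"
  have act0: "act a 0 = 0" for a
    using assms(1) by (simp add: group_with_operators_def additive.zero)
  have "?g x = 0" if notin: "x \<notin> ?S" for x
  proof -
    obtain i j k where x: "x = (i, j, k)"
      by (cases x)
    consider "i > degree p" | "j > degree q" | "k > i"
      using notin x by fastforce
    then show ?thesis
      by cases (simp_all add: x coeff_eq_0 assms(2) act0 ore_pi_zero[OF assms(3,4)] ore_pi_eq_0)
  qed
  then have "{x. ?g x \<noteq> 0} \<subseteq> ?S"
    by blast
  then have "Sum_any ?g = sum ?g ?S"
    by (intro Sum_any.expand_superset) auto
  also have "\<dots> = ore_action act \<sigma> \<delta> p q"
    by (simp add: ore_action_def sum.Sigma)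
  finally show ?thesis
    by simp
qed

end

theory Submission
  imports Defs
begin

text \<open>Let \<open>L n I\<close> be the group of \<open>n\<close>-th coefficients of the elements of \<open>I\<close> of degree at most
  \<open>n\<close>. Without a unit there is no operator \<open>x\<close>, but \<open>a x\<close> sends the leading coefficient \<open>b\<close> to
  \<open>a \<sigma>(b)\<close>, and weak \<open>s\<close>-unitality recovers \<open>\<sigma>(b)\<close> from these, so \<open>\<sigma>(L n I) \<subseteq> L (n + 1) I\<close>.
  Preimages of stable subgroups under \<open>\<sigma>\<close> are stable, hence the preimages \<open>\<sigma>\<^sup>-\<^sup>n(L n I)\<close> form an
  ascending chain in \<open>n\<close> as well as in \<open>I\<close>, and Hilbert's basis argument applies to them;
  surjectivity of \<open>\<sigma>\<close> recovers \<open>L n I\<close> from its preimage.\<close>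

section \<open>Stable subgroups: preimages and brackets\<close>

lemma stable_subgroup_diff:
  assumes "stable_subgroup act H" "x \<in> H" "y \<in> H"
  shows "x - y \<in> H"
proof -
  have "x + - y \<in> H"
    using assms unfolding stable_subgroup_def by blast
  then show ?thesis by simp
qed

text \<open>An \<open>A\<close>-stable \<open>f\<close> sends \<open>act s h\<close> to
  \<open>act a (f h)\<close> for some \<open>a\<close> that may differ from \<open>s\<close> and
  depend on \<open>h\<close>. This suffices, as \<open>H\<close> is stable under all operators at
  once.\<close>

lemma stable_subgroup_vimage:
  assumes "stable_subgroup act H" "additive f" "stable_map act f"
  shows "stable_subgroup act (f -` H)"
proof -
  have "f (act s h) \<in> H" if "f h \<in> H" for s h
  proof -
    obtain a where "f (act s h) = act a (f h)"
      using assms(3) by (fastforce simp: stable_map_def)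
    then show ?thesis
      using assms(1) that by (simp add: stable_subgroup_def)
  qed
  then show ?thesis
    using assms(1) by (auto simp: stable_subgroup_def additive.add[OF assms(2)]
        additive.zero[OF assms(2)] additive.minus[OF assms(2)])
qed

lemma stable_subgroup_vimage_funpow:
  assumes "stable_subgroup act H" "additive f" "stable_map act f"
  shows "stable_subgroup act ((f ^^ n) -` H)"
  using assms(1)
proof (induction n arbitrary: H)
  case (Suc n)
  then have "stable_subgroup act ((f ^^ n) -` (f -` H))"
    using assms(2,3) stable_subgroup_vimage by blast
  then show ?case
    by (simp add: vimage_comp comp_def)
qed simp

text \<open>Only the elements \<open>act a b\<close> are assumed to lie in \<open>H\<close>, not
  \<open>b\<close> itself: weak \<open>s\<close>-unitality is then what brings \<open>b\<close> into
  \<open>H\<close>.\<close>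

lemma bracket_subset:
  assumes "stable_subgroup act H" "\<And>a. act a b \<in> H"
  shows "bracket act b \<subseteq> H"
proof
  have orbit: "c \<in> H" if c: "c \<in> (\<Union>n\<in>{1..}. iterated_orbit act n b)" for c
  proof -
    obtain as where "c = foldr act as b" "length as \<ge> 1"
      using c unfolding iterated_orbit_def by fastforce
    then have "c = foldr act as b" "as \<noteq> []"
      by auto
    \<comment> \<open>The innermost operator applied to \<open>b\<close> lands in \<open>H\<close>
      by assumption, and stability covers the outer ones. The empty word would give
      \<open>b\<close>, hence \<open>as \<noteq> []\<close>.\<close>
    moreover have "foldr act as b \<in> H" if "as \<noteq> []" for as
      using that
    proof (induction as)
      case (Cons a as)
      then show ?case
        using assms by (cases as) (auto simp: stable_subgroup_def)
    qed simp
    ultimately show ?thesis by simp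
  qed
  fix c assume "c \<in> bracket act b"
  then obtain bs where c: "c = sum_list bs"
    and bs: "\<forall>c\<in>set bs. c \<in> (\<Union>n\<in>{1..}. iterated_orbit act n b) \<or>
                        - c \<in> (\<Union>n\<in>{1..}. iterated_orbit act n b)"
    unfolding bracket_def by blast
  have "\<forall>c\<in>set bs. c \<in> H"
  proof
    fix c assume "c \<in> set bs"
    then have "c \<in> H \<or> - c \<in> H"
      using bs orbit by blast
    then show "c \<in> H"
      using assms(1) unfolding stable_subgroup_def by (metis minus_minus)
  qed
  then have "sum_list bs \<in> H"
    using assms(1) by (induction bs) (auto simp: stable_subgroup_def)
  then show "c \<in> H"
    by (simp add: c)
qed

section \<open>The maps \<open>ore_pi\<close> for words of length at most one\<close>

lemma additive_ore_pi:
  assumes "additive \<sigma>" "additive \<delta>"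
  shows "additive (ore_pi \<sigma> \<delta> i j)"
proof
  fix x y
  have "foldr (\<lambda>s. if s then \<sigma> else \<delta>) w (x + y) =
      foldr (\<lambda>s. if s then \<sigma> else \<delta>) w x + foldr (\<lambda>s. if s then \<sigma> else \<delta>) w y" for w
    by (induction w) (simp_all add: additive.add assms)
  then show "ore_pi \<sigma> \<delta> i j (x + y) = ore_pi \<sigma> \<delta> i j x + ore_pi \<sigma> \<delta> i j y"
    by (simp add: ore_pi_def sum.distrib)
qed

lemma ore_pi_0_0: "ore_pi \<sigma> \<delta> 0 0 b = b"
proof -
  have "{w. length w = 0 \<and> count_list w True = 0} = {[]}"
    by auto
  then show ?thesis
    unfolding ore_pi_def by simp
qed

lemma ore_pi_1_0: "ore_pi \<sigma> \<delta> (Suc 0) 0 b = \<delta> b"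
proof -
  have "{w. length w = Suc 0 \<and> count_list w True = 0} = {[False]}"
    by (auto simp: length_Suc_conv)
  then show ?thesis
    unfolding ore_pi_def by simp
qed

lemma ore_pi_1_1: "ore_pi \<sigma> \<delta> (Suc 0) (Suc 0) b = \<sigma> b"
proof -
  have "{w. length w = Suc 0 \<and> count_list w True = Suc 0} = {[True]}"
    by (auto simp: length_Suc_conv split: if_splits)
  then show ?thesis
    unfolding ore_pi_def by simp
qed

section \<open>Leading coefficients\<close>

definition lead_coeffs :: "nat \<Rightarrow> 'b::zero poly set \<Rightarrow> 'b set" where
  "lead_coeffs n I = {coeff q n | q. q \<in> I \<and> degree q \<le> n}"

lemma lead_coeffs_mono: "I \<subseteq> J \<Longrightarrow> lead_coeffs n I \<subseteq> lead_coeffs n J"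
  unfolding lead_coeffs_def by blast

text \<open>Division step of Hilbert's basis argument: subtracting an element of \<open>I\<close>
  with the same leading coefficient lowers the degree and stays in \<open>J\<close>.\<close>

lemma subset_of_lead_coeffs:
  assumes I: "stable_subgroup act I" and J: "stable_subgroup act J" and sub: "I \<subseteq> J"
    and lead: "\<And>n. lead_coeffs n J \<subseteq> lead_coeffs n I"
  shows "J \<subseteq> I"
proof
  fix q assume "q \<in> J"
  \<comment> \<open>The size of \<open>q\<close> is measured by where its coefficients start to
    vanish, not by \<open>degree\<close>, so that the zero polynomial (also of degree 0) is the base
    case, apart from the constants.\<close>
  have "q \<in> I" if "q \<in> J" "\<forall>i\<ge>n. coeff q i = 0" for q n
    using that
  proof (induction n arbitrary: q)
    case 0
    then have "q = 0"
      by (simp add: poly_eq_iff)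
    then show ?case
      using I by (simp add: stable_subgroup_def)
  next
    case (Suc n)
    then have "degree q \<le> n"
      by (simp add: degree_le)
    then have "coeff q n \<in> lead_coeffs n I"
      using lead Suc.prems(1) unfolding lead_coeffs_def by blast
    then obtain r where r: "r \<in> I" "degree r \<le> n" "coeff r n = coeff q n"
      unfolding lead_coeffs_def by auto
    have "coeff (q - r) i = 0" if "i \<ge> n" for i
      using that r(2,3) Suc.prems(2) by (cases "i = n") (auto simp: coeff_eq_0)
    moreover have "q - r \<in> J"
      using Suc.prems(1) r(1) sub J by (blast intro: stable_subgroup_diff)
    ultimately have "q - r \<in> I"
      using Suc.IH by blast
    then have "(q - r) + r \<in> I"
      using I r(1) unfolding stable_subgroup_def by blast
    then show ?case by simp
  qed
  from this[OF \<open>q \<in> J\<close>, of "Suc (degree q)"] show "q \<in> I"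
    by (simp add: coeff_eq_0)
qed

section \<open>The Ore action and its effect on coefficients\<close>

locale ore_group_extension =
  fixes act :: "'a::zero \<Rightarrow> 'b::ab_group_add \<Rightarrow> 'b"
    and \<sigma> \<delta> :: "'b \<Rightarrow> 'b"
  assumes operators: "group_with_operators act"
    and act_0_left: "act 0 b = 0"
    and additive_\<sigma>: "additive \<sigma>" and additive_\<delta>: "additive \<delta>"
begin

lemma additive_act: "additive (act a)"
  using operators by (simp add: group_with_operators_def)

lemma act_0_right: "act a 0 = 0"
  by (rule additive.zero[OF additive_act])

text \<open>Terms beyond the degrees vanish: for \<open>p\<close> because the operator 0 kills
  \<open>B\<close>, for \<open>q\<close> because all maps involved are additive. Larger bounds let
  sums for different polynomials share one range.\<close>

lemma ore_action_bounded:
  assumes "degree p \<le> m" "degree q \<le> n"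
  shows "ore_action act \<sigma> \<delta> p q =
     (\<Sum>i\<le>m. \<Sum>j\<le>n. \<Sum>k\<le>i.
        monom (act (coeff p i) (ore_pi \<sigma> \<delta> i k (coeff q j))) (k + j))"
    (is "_ = (\<Sum>i\<le>m. \<Sum>j\<le>n. ?t i j)")
proof -
  have "?t i j = 0" if "j > degree q" for i j
    using that by (simp add: coeff_eq_0 ore_pi_zero additive_\<sigma> additive_\<delta> act_0_right)
  then have "(\<Sum>j\<le>degree q. ?t i j) = (\<Sum>j\<le>n. ?t i j)" for i
    by (intro sum.mono_neutral_left) (use assms in auto)
  moreover have "(\<Sum>i\<le>degree p. \<Sum>j\<le>n. ?t i j) = (\<Sum>i\<le>m. \<Sum>j\<le>n. ?t i j)"
    by (intro sum.mono_neutral_left) (use assms in \<open>auto simp: coeff_eq_0 act_0_left\<close>)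
  ultimately show ?thesis
    by (simp add: ore_action_def)
qed

lemma group_with_operators_ore_action: "group_with_operators (ore_action act \<sigma> \<delta>)"
  unfolding group_with_operators_def
proof (intro allI additive.intro)
  fix p and q r :: "'b poly"
  define n where "n = max (degree q) (degree r)"
  have "degree q \<le> n" "degree r \<le> n" "degree (q + r) \<le> n"
    by (auto simp: n_def degree_add_le)
  then show "ore_action act \<sigma> \<delta> p (q + r) = ore_action act \<sigma> \<delta> p q + ore_action act \<sigma> \<delta> p r"
    by (simp add: ore_action_bounded[OF order_refl] additive.add[OF additive_act]
        additive.add[OF additive_ore_pi[OF additive_\<sigma> additive_\<delta>]]
        add_monom[symmetric] sum.distrib)
qed

lemma coeff_ore_action_const:
  "coeff (ore_action act \<sigma> \<delta> (monom a 0) q) m = act a (coeff q m)"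
proof -
  \<comment> \<open>The maximum ensures that the index \<open>m\<close> occurs in the sum even when
    it exceeds the degree of \<open>q\<close>.\<close>
  have "coeff (ore_action act \<sigma> \<delta> (monom a 0) q) m =
      (\<Sum>j\<le>max m (degree q). if j = m then act a (coeff q j) else 0)"
    by (simp add: ore_action_bounded[OF degree_monom_le, of q "max m (degree q)"]
        ore_pi_0_0 coeff_sum del: max.bounded_iff)
  then show ?thesis
    by simp
qed

text \<open>Only words of length one contribute: \<open>\<delta>\<close> keeps the exponent and
  \<open>\<sigma>\<close> raises it by one.\<close>

lemma coeff_ore_action_linear:
  "coeff (ore_action act \<sigma> \<delta> (monom a (Suc 0)) q) (Suc m) =
     act a (\<delta> (coeff q (Suc m))) + act a (\<sigma> (coeff q m))"
proof -
  define n where "n = max (Suc m) (degree q)"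
  have n: "degree q \<le> n" "Suc m \<le> n"
    by (auto simp: n_def)
  have "coeff (ore_action act \<sigma> \<delta> (monom a (Suc 0)) q) (Suc m) =
      (\<Sum>j\<le>n. (if j = Suc m then act a (\<delta> (coeff q j)) else 0) +
              (if j = m then act a (\<sigma> (coeff q j)) else 0))"
    by (simp add: ore_action_bounded[OF degree_monom_le n(1)]
        ore_pi_1_0 ore_pi_1_1 coeff_sum act_0_left)
  also have "\<dots> = act a (\<delta> (coeff q (Suc m))) + act a (\<sigma> (coeff q m))"
    unfolding sum.distrib using n by simp
  finally show ?thesis .
qed

text \<open>Bounding the degree by \<open>n\<close>, rather than fixing it, gives closure under sums
  whose leading terms cancel. Constant operators \<open>monom a 0\<close> act coefficientwise,
  whence stability.\<close>

lemma stable_subgroup_lead_coeffs: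
  assumes I: "stable_subgroup (ore_action act \<sigma> \<delta>) I"
  shows "stable_subgroup act (lead_coeffs n I)"
  unfolding stable_subgroup_def
proof (intro conjI ballI allI)
  have "coeff 0 n \<in> lead_coeffs n I"
    using I unfolding lead_coeffs_def stable_subgroup_def
    by (intro CollectI exI[of _ 0]) simp
  then show "0 \<in> lead_coeffs n I"
    by simp
next
  fix x y assume "x \<in> lead_coeffs n I" "y \<in> lead_coeffs n I"
  then obtain q r where "q \<in> I" "r \<in> I" "degree q \<le> n" "degree r \<le> n"
    "x = coeff q n" "y = coeff r n"
    unfolding lead_coeffs_def by blast
  then show "x + y \<in> lead_coeffs n I"
    using I unfolding lead_coeffs_def stable_subgroup_def
    by (intro CollectI exI[of _ "q + r"]) (simp add: degree_add_le)
next
  fix x assume "x \<in> lead_coeffs n I"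
  then obtain q where "q \<in> I" "degree q \<le> n" "x = coeff q n"
    unfolding lead_coeffs_def by blast
  then show "- x \<in> lead_coeffs n I"
    using I unfolding lead_coeffs_def stable_subgroup_def
    by (intro CollectI exI[of _ "- q"]) simp
next
  fix a x assume "x \<in> lead_coeffs n I"
  then obtain q where q: "q \<in> I" "degree q \<le> n" "x = coeff q n"
    unfolding lead_coeffs_def by blast
  have "degree (ore_action act \<sigma> \<delta> (monom a 0) q) \<le> n"
    using q(2) by (intro degree_le) (simp add: coeff_ore_action_const coeff_eq_0 act_0_right)
  then show "act a x \<in> lead_coeffs n I"
    using I q unfolding lead_coeffs_def stable_subgroup_def
    by (intro CollectI exI[of _ "ore_action act \<sigma> \<delta> (monom a 0) q"])
      (simp add: coeff_ore_action_const)
qed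

lemma lead_coeffs_Suc:
  assumes I: "stable_subgroup (ore_action act \<sigma> \<delta>) I"
    and unital: "weakly_s_unital act" and b: "b \<in> lead_coeffs n I"
  shows "\<sigma> b \<in> lead_coeffs (Suc n) I"
proof -
  obtain q where q: "q \<in> I" "degree q \<le> n" "b = coeff q n"
    using b unfolding lead_coeffs_def by blast
  have "act a (\<sigma> b) \<in> lead_coeffs (Suc n) I" for a
  proof -
    let ?r = "ore_action act \<sigma> \<delta> (monom a (Suc 0)) q"
    have "coeff ?r i = 0" if "i > Suc n" for i
      using that q(2)
      by (cases i) (simp_all add: coeff_ore_action_linear coeff_eq_0 act_0_right
          additive.zero[OF additive_\<sigma>] additive.zero[OF additive_\<delta>])
    then have "degree ?r \<le> Suc n"
      by (simp add: degree_le)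
    \<comment> \<open>The \<open>\<delta>\<close> term disappears because \<open>q\<close> has no
      coefficient at \<open>Suc n\<close>.\<close>
    moreover have "coeff ?r (Suc n) = act a (\<sigma> b)"
      using q by (simp add: coeff_ore_action_linear coeff_eq_0 act_0_right
          additive.zero[OF additive_\<delta>])
    moreover have "?r \<in> I"
      using I q(1) by (simp add: stable_subgroup_def)
    ultimately show ?thesis
      unfolding lead_coeffs_def by (metis (mono_tags, lifting) mem_Collect_eq)
  qed
  then have "bracket act (\<sigma> b) \<subseteq> lead_coeffs (Suc n) I"
    by (intro bracket_subset stable_subgroup_lead_coeffs[OF I])
  then show ?thesis
    using unital unfolding weakly_s_unital_def by blast
qed

section \<open>Stabilization of the double chain\<close>

theorem stably_noetherian_ore_action:
  assumes noeth: "stably_noetherian act" and unital: "weakly_s_unital act"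
    and stable: "stable_map act \<sigma>" and "surj \<sigma>"
  shows "stably_noetherian (ore_action act \<sigma> \<delta>)"
  unfolding stably_noetherian_def
proof (intro allI impI, elim conjE)
  fix H :: "nat \<Rightarrow> 'b poly set"
  assume H: "\<forall>m. stable_subgroup (ore_action act \<sigma> \<delta>) (H m)" and "mono H"
  define M where "M n m = (\<sigma> ^^ n) -` lead_coeffs n (H m)" for n m
  have stable_M: "stable_subgroup act (M n m)" for n m
    unfolding M_def using H
    by (intro stable_subgroup_vimage_funpow stable_subgroup_lead_coeffs additive_\<sigma> stable) auto
  have "M n m \<subseteq> M (Suc n) m" for n m
    unfolding M_def using lead_coeffs_Suc[OF _ unital] H by auto
  then have M_mono1: "M n m \<subseteq> M n' m" if "n \<le> n'" for n n' m
    using that by (rule lift_Suc_mono_le[of "\<lambda>n. M n m"])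
  have M_mono2: "M n m \<subseteq> M n m'" if "m \<le> m'" for n m m'
    unfolding M_def using that \<open>mono H\<close> by (intro vimage_mono lead_coeffs_mono) (rule monoD)
  have M_mono: "M n m \<subseteq> M n' m'" if "n \<le> n'" "m \<le> m'" for n n' m m'
    using M_mono1[OF that(1)] M_mono2[OF that(2)] by blast
  \<comment> \<open>The diagonal controls all \<open>M n m\<close> with \<open>n\<close> and
    \<open>m\<close> at least \<open>N\<close>; the finitely many rows \<open>n \<le> N\<close>
    stabilize one by one, row \<open>n\<close> from \<open>K n\<close> on.\<close>
  have "mono (\<lambda>n. M n n)"
    by (intro monoI M_mono)
  then obtain N where N: "\<And>n. n \<ge> N \<Longrightarrow> M n n = M N N"
    using noeth stable_M unfolding stably_noetherian_def by (metis (no_types, lifting))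
  have "\<exists>K. \<forall>m\<ge>K. M n m = M n K" for n
  proof -
    have "mono (M n)"
      by (intro monoI M_mono order_refl)
    then show ?thesis
      using noeth stable_M unfolding stably_noetherian_def by blast
  qed
  then obtain K where K: "\<And>n m. m \<ge> K n \<Longrightarrow> M n m = M n (K n)"
    by metis
  define R where "R = Max (insert N (K ` {..N}))"
  have "N \<le> R"
    unfolding R_def by simp
  have K_le: "K n \<le> R" if "n \<le> N" for n
    unfolding R_def using that by (intro Max_ge) auto
  have M_R: "M n m \<subseteq> M n R" if "m \<ge> R" for n m
  proof (cases "n \<le> N")
    case True
    then show ?thesis
      using K[of n m] K[of n R] K_le[of n] that by simp
  next
    case False
    \<comment> \<open>Rows above \<open>N\<close> are squeezed: \<open>M n m\<close> is contained in
      a diagonal term past \<open>N\<close>, which equals \<open>M N N\<close> and so lies in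
      \<open>M n R\<close>.\<close>
    have "M n m \<subseteq> M (max n m) (max n m)"
      by (intro M_mono) auto
    also have "\<dots> = M N N"
      using False by (intro N) simp
    also have "\<dots> \<subseteq> M n R"
      using False \<open>N \<le> R\<close> by (intro M_mono) auto
    finally show ?thesis .
  qed
  have "H m = H R" if "m \<ge> R" for m
  proof
    show "H R \<subseteq> H m"
      using that \<open>mono H\<close> by (simp add: monoD)
    \<comment> \<open>Surjectivity makes taking the preimage under \<open>\<sigma> ^^ n\<close>
      reversible, so inclusions between the \<open>M n m\<close> descend to leading
      coefficients.\<close>
    have image_M: "(\<sigma> ^^ n) ` M n m = lead_coeffs n (H m)" for n m
      unfolding M_def using surj_fn[OF \<open>surj \<sigma>\<close>, of n] by (simp add: surj_image_vimage_eq)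
    have "lead_coeffs n (H m) \<subseteq> lead_coeffs n (H R)" for n
      using image_mono[OF M_R[OF that]] by (metis image_M)
    then show "H m \<subseteq> H R"
      using subset_of_lead_coeffs H \<open>H R \<subseteq> H m\<close> by blast
  qed
  then show "\<exists>R. \<forall>m\<ge>R. H m = H R"
    by blast
qed

end

theorem theorem33:
  fixes act :: "'a::zero \<Rightarrow> 'b::ab_group_add \<Rightarrow> 'b"
    and \<sigma> \<delta> :: "'b \<Rightarrow> 'b"
  assumes "group_with_operators act"
    and "\<And>b. act 0 b = 0"
    and "additive \<sigma>" and "additive \<delta>"
    and "stably_noetherian act"
    and "weakly_s_unital act"
    and "stable_map act \<sigma>" and "surj \<sigma>"
  shows "group_with_operators (ore_action act \<sigma> \<delta>) \<and>
         stably_noetherian (ore_action act \<sigma> \<delta>)"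
proof -
  interpret ore_group_extension act \<sigma> \<delta>
    using assms(1-4) by (intro ore_group_extension.intro)
  show ?thesis
    using group_with_operators_ore_action stably_noetherian_ore_action assms(5-8) by blast
qed

end
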